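(* Let $X$ be a topological space (no separation axioms are assumed). Then $X$ is strongly $\sigma$-metrizable if and only if $X$ is super $\sigma$-metrizable.
   Context: A topological space $X$ is called strongly $\sigma$-metrizable if $X=\bigcup_{n\in\omega}X_n$ for some increasing sequence $(X_n)_{n\in\omega}$ (i.e. $X_n\subseteq X_{n+1}$ for all $n$) of closed subspaces of $X$, each metrizable in the subspace topology, such that every convergent sequence in $X$ is contained in some $X_n$; that is, for every sequence $(x_k)_{k\in\omega}$ of points of $X$ converging to some point of $X$ there is $n\in\omega$ with $\{x_k:k\in\omega\}\subseteq X_n$. A topological space $X$ is called super $\sigma$-metrizable if $X=\bigcup_{n\in\omega}X_n$ for some increasing sequence $(X_n)_{n\in\omega}$ of closed metrizable subspaces of $X$ such that every compact subset of $X$ is contained in some $X_n$. Here "compact" means that every open cover has a finite subcover; compact sets are not assumed to be Hausdorff or closed. $\omega$ denotes the set of non-negative integers. *)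

theory Defs
  imports "HOL-Analysis.Analysis"
begin

text \<open>An increasing cover of the space by closed subspaces, each metrizable in the
  subspace topology.\<close>

definition metrizable_filtration :: "'a topology \<Rightarrow> (nat \<Rightarrow> 'a set) \<Rightarrow> bool" where
  "metrizable_filtration X A \<longleftrightarrow>
     topspace X = (\<Union>n. A n) \<and>
     (\<forall>n. A n \<subseteq> A (Suc n)) \<and>
     (\<forall>n. closedin X (A n)) \<and>
     (\<forall>n. metrizable_space (subtopology X (A n)))"

text \<open>In \<^const>\<open>limitin\<close> only the limit is required to be a point of the space, and only
  a tail of the sequence is constrained; that all terms are points of the space is
  therefore a separate condition.\<close>

definition strongly_sigma_metrizable :: "'a topology \<Rightarrow> bool" where
  "strongly_sigma_metrizable X \<longleftrightarrow>
     (\<exists>A. metrizable_filtration X A \<and>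
       (\<forall>x :: nat \<Rightarrow> 'a. range x \<subseteq> topspace X \<and> (\<exists>l. limitin X x l sequentially)
          \<longrightarrow> (\<exists>n. range x \<subseteq> A n)))"

definition super_sigma_metrizable :: "'a topology \<Rightarrow> bool" where
  "super_sigma_metrizable X \<longleftrightarrow>
     (\<exists>A. metrizable_filtration X A \<and>
       (\<forall>K. compactin X K \<longrightarrow> (\<exists>n. K \<subseteq> A n)))"

end

theory Submission
  imports Defs "HOL-Library.Diagonal_Subsequence"
begin

text \<open>
  A compact set \<open>K\<close> is the union of its traces on the members of the filtration, which are compact
  metrizable and hence second countable; so \<open>K\<close> has a countable network, the union of countable bases
  of the traces. A compact set with a countable network is sequentially compact, without any
  separation axiom: pass to a diagonal subsequence such that for each network set \<open>V\<close> either some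
  open superset of \<open>V\<close> is eventually avoided, or every open superset of \<open>V\<close> eventually contains the
  subsequence. Compactness yields a cluster point; the first alternative fails for every \<open>V\<close>
  containing it, so it is a limit. If \<open>K\<close> lay in no \<open>A n\<close>, a sequence \<open>x k \<in> K - A k\<close> would therefore have a
  convergent subsequence, which is contained in no \<open>A n\<close> either. Conversely, a convergent sequence
  together with its limit is compact. Both directions keep the filtration.
\<close>

text \<open>Total boundedness gives a finite net of radius \<open>inverse (Suc n)\<close> for each
  \<open>n\<close>; the balls of these radii around the net points form a countable base.\<close>

lemma compact_metrizable_imp_second_countable:
  assumes "compact_space X" "metrizable_space X"
  shows "second_countable X"
proof -
  obtain M d where "Metric_space M d" and X: "X = Metric_space.mtopology M d"
    using assms(2) unfolding metrizable_space_def by blast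
  interpret Metric_space M d by fact
  have "mtotally_bounded M"
    using assms(1) X by (metis compact_space_def compactin_imp_mtotally_bounded topspace_mtopology)
  then have "\<exists>F. finite F \<and> F \<subseteq> M \<and> M \<subseteq> (\<Union>x\<in>F. mball x (inverse (Suc n)))" for n :: nat
    unfolding mtotally_bounded_def by (meson inverse_positive_iff_positive of_nat_0_less_iff zero_less_Suc)
  then obtain F where F: "\<And>n. finite (F n)" "\<And>n. F n \<subseteq> M"
      "\<And>n. M \<subseteq> (\<Union>x\<in>F n. mball x (inverse (Suc n)))"
    by metis
  define \<B> where "\<B> = (\<Union>n. (\<lambda>x. mball x (inverse (Suc n))) ` F n)"
  have "countable \<B>"
    unfolding \<B>_def using F(1) by (intro countable_UN countable_image) (auto intro: countable_finite)
  moreover have "openin mtopology V" if "V \<in> \<B>" for V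
    using that by (auto simp: \<B>_def)
  moreover have "\<exists>V\<in>\<B>. y \<in> V \<and> V \<subseteq> U" if U: "openin mtopology U" "y \<in> U" for U y
  proof -
    obtain r where r: "r > 0" "mball y r \<subseteq> U" and y: "y \<in> M"
      using U by (metis openin_mtopology subsetD)
    \<comment> \<open>Half of \<open>r\<close> suffices: any two points of the small ball are then
      less than \<open>r\<close> apart.\<close>
    obtain n where n: "inverse (real (Suc n)) < r / 2"
      using reals_Archimedean[of "r/2"] r by auto
    obtain x where x: "x \<in> F n" "y \<in> mball x (inverse (Suc n))"
      using F(3) y by blast
    have "mball x (inverse (Suc n)) \<subseteq> mball y r"
    proof
      fix z assume z: "z \<in> mball x (inverse (Suc n))"
      then have "d y z \<le> d x y + d x z"
        using x(2) by (metis commute in_mball triangle)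
      with z x(2) n y show "z \<in> mball y r" by simp
    qed
    then show ?thesis using x r(2) unfolding \<B>_def by blast
  qed
  ultimately show ?thesis
    unfolding second_countable_def X by metis
qed

text \<open>Members of \<open>\<N>\<close> may fail to be open and matter only through their traces
  on \<open>K\<close>, so bases of different subspaces can be pooled to form
  \<open>\<N>\<close>.\<close>

lemma compactin_countable_network_convergent_subsequence:
  fixes x :: "nat \<Rightarrow> 'a"
  assumes K: "compactin X K" and \<N>: "countable \<N>"
    and network: "\<And>U y. openin X U \<Longrightarrow> y \<in> U \<inter> K \<Longrightarrow> \<exists>V\<in>\<N>. y \<in> V \<and> V \<inter> K \<subseteq> U"
    and x: "range x \<subseteq> K"
  obtains r l where "strict_mono (r :: nat \<Rightarrow> nat)" "l \<in> K" "limitin X (x \<circ> r) l sequentially"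
proof -
  have "x 0 \<in> topspace X \<inter> K"
    using x compactin_subset_topspace[OF K] by auto
  then have "\<N> \<noteq> {}"
    using network[OF openin_topspace] by blast
  define V where "V = from_nat_into \<N>"
  \<comment> \<open>Both properties pass to subsequences and ignore finitely many initial terms,
    which is what the diagonal argument requires.\<close>
  define avoided where "avoided n s \<longleftrightarrow>
      (\<exists>U. openin X U \<and> V n \<inter> K \<subseteq> U \<and> (\<forall>\<^sub>F k in sequentially. x (s k) \<notin> U))" for n s
  define attracting where "attracting n s \<longleftrightarrow>
      (\<forall>U. openin X U \<and> V n \<inter> K \<subseteq> U \<longrightarrow> (\<forall>\<^sub>F k in sequentially. x (s k) \<in> U))" for n s
  have tail: "\<forall>\<^sub>F k in sequentially. P (s (r k))"
    if "\<forall>\<^sub>F k in sequentially. P (s k)" "strict_mono r" for P and s r :: "nat \<Rightarrow> nat"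
    using eventually_subseq[OF that(2,1)] .
  interpret subseqs "\<lambda>n s. avoided n s \<or> attracting n s"
  proof
    fix n and s :: "nat \<Rightarrow> nat"
    assume "strict_mono s"
    show "\<exists>r. strict_mono r \<and> (avoided n (s \<circ> r) \<or> attracting n (s \<circ> r))"
    proof (cases "attracting n s")
      case True
      then show ?thesis by (metis comp_id strict_mono_id)
    next
      case False
      \<comment> \<open>Enumerating the infinitely many indices at which \<open>U\<close> is missed
        gives a subsequence that never enters \<open>U\<close>, so the same \<open>U\<close>
        witnesses \<open>avoided\<close>.\<close>
      then obtain U where U: "openin X U" "V n \<inter> K \<subseteq> U" "\<exists>\<^sub>F k in sequentially. x (s k) \<notin> U"
        unfolding attracting_def not_eventually[symmetric] by blast
      then have "infinite {k. x (s k) \<notin> U}"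
        by (simp add: frequently_cofinite flip: cofinite_eq_sequentially)
      then obtain r :: "nat \<Rightarrow> nat" where "strict_mono r" "\<And>k. x (s (r k)) \<notin> U"
        using infinite_enumerate by blast
      moreover from this U have "avoided n (s \<circ> r)"
        unfolding avoided_def by (intro exI[of _ U]) simp
      ultimately show ?thesis by blast
    qed
  qed
  have avoided_or_attracting: "avoided n diagseq \<or> attracting n diagseq" for n
  proof -
    \<comment> \<open>\<open>diagseq_holds\<close> speaks only of the tail of \<open>diagseq\<close>
      from \<open>Suc n\<close> on; invariance under shifts carries the dichotomy back to
      \<open>diagseq\<close> itself.\<close>
    have shift: "(\<forall>\<^sub>F k in sequentially. P ((s \<circ> (+) m) k)) \<longleftrightarrow>
        (\<forall>\<^sub>F k in sequentially. P (s k))" for P and s :: "nat \<Rightarrow> nat" and m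
      using eventually_sequentially_seg[of "\<lambda>k. P (s k)" m] by (simp add: add.commute)
    have "avoided n (s \<circ> (+) m) \<longleftrightarrow> avoided n s"
      "attracting n (s \<circ> (+) m) \<longleftrightarrow> attracting n s" for s m
      unfolding avoided_def attracting_def
      using shift[of "\<lambda>j. x j \<notin> _" s m] shift[of "\<lambda>j. x j \<in> _" s m] by simp_all
    moreover have "avoided n (diagseq \<circ> (+) (Suc n)) \<or> attracting n (diagseq \<circ> (+) (Suc n))"
    proof (rule diagseq_holds)
      fix r s :: "nat \<Rightarrow> nat" and m
      assume "strict_mono r" "avoided m s \<or> attracting m s"
      then show "avoided m (s \<circ> r) \<or> attracting m (s \<circ> r)"
        unfolding avoided_def attracting_def comp_apply
        using tail[of "\<lambda>j. x j \<in> _" s r] tail[of "\<lambda>j. x j \<notin> _" s r] by meson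
    qed
    ultimately show ?thesis by blast
  qed
  obtain l where l: "l \<in> K"
    and cluster: "\<And>U. openin X U \<Longrightarrow> l \<in> U \<Longrightarrow> \<exists>\<^sub>F k in sequentially. x (diagseq k) \<in> U"
  proof (rule ccontr)
    assume "\<not> thesis"
    \<comment> \<open>Finitely many of these neighbourhoods cover \<open>K\<close>, and at a late
      index the sequence misses them all although its terms lie in \<open>K\<close>.\<close>
    then have "\<forall>y\<in>K. \<exists>U. openin X U \<and> y \<in> U \<and> (\<forall>\<^sub>F k in sequentially. x (diagseq k) \<notin> U)"
      using that unfolding frequently_def by blast
    from bchoice[OF this] obtain U where
      U: "\<forall>y\<in>K. openin X (U y) \<and> y \<in> U y \<and> (\<forall>\<^sub>F k in sequentially. x (diagseq k) \<notin> U y)"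
      by blast
    have "\<exists>\<F>. finite \<F> \<and> \<F> \<subseteq> U ` K \<and> K \<subseteq> \<Union>\<F>"
      using K U by (intro compactinD) auto
    then obtain F where F: "finite F" "F \<subseteq> K" "K \<subseteq> \<Union>(U ` F)"
      by (metis finite_subset_image)
    then have "\<forall>\<^sub>F k in sequentially. \<forall>y\<in>F. x (diagseq k) \<notin> U y"
      using U by (intro eventually_ball_finite) auto
    then obtain k where "\<forall>y\<in>F. x (diagseq k) \<notin> U y"
      using eventually_happens'[OF sequentially_bot] by blast
    then show False using F(3) x by blast
  qed
  have "limitin X (x \<circ> diagseq) l sequentially"
    unfolding limitin_def
  proof (intro conjI allI impI)
    show "l \<in> topspace X" using l K compactin_subset_topspace by blast
    fix U assume U: "openin X U \<and> l \<in> U"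
    then obtain n where n: "l \<in> V n" "V n \<inter> K \<subseteq> U"
      using network[of U l] l from_nat_into_surj[OF \<N>] unfolding V_def by blast
    \<comment> \<open>A witness of \<open>avoided\<close> would be an open set around
      \<open>l\<close> that is eventually missed, against the choice of \<open>l\<close>.\<close>
    have "\<not> avoided n diagseq"
      using cluster n(1) l unfolding avoided_def frequently_def by blast
    then show "\<forall>\<^sub>F k in sequentially. (x \<circ> diagseq) k \<in> U"
      using avoided_or_attracting[of n] U n(2) unfolding attracting_def by auto
  qed
  with that subseq_diagseq l show thesis by blast
qed

lemma metrizable_filtration_compactin_countable_network:
  assumes A: "metrizable_filtration X A" and K: "compactin X K"
  obtains \<N> where "countable \<N>"
    "\<And>U y. openin X U \<Longrightarrow> y \<in> U \<inter> K \<Longrightarrow> \<exists>V\<in>\<N>. y \<in> V \<and> V \<inter> K \<subseteq> U"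
proof -
  have "second_countable (subtopology X (A n \<inter> K))" for n
  proof (rule compact_metrizable_imp_second_countable)
    show "compact_space (subtopology X (A n \<inter> K))"
      using A K closed_Int_compactin unfolding metrizable_filtration_def
      by (blast intro: compact_space_subtopology)
    show "metrizable_space (subtopology X (A n \<inter> K))"
      using A metrizable_space_subtopology unfolding metrizable_filtration_def
      by (metis subtopology_subtopology)
  qed
  then obtain \<B> where \<B>: "\<And>n. countable (\<B> n)"
      "\<And>n U y. openin (subtopology X (A n \<inter> K)) U \<Longrightarrow> y \<in> U \<Longrightarrow> \<exists>V\<in>\<B> n. y \<in> V \<and> V \<subseteq> U"
    unfolding second_countable_def by metis
  show thesis
  proof
    show "countable (\<Union>n. \<B> n)" using \<B>(1) by blast
    fix U y assume U: "openin X U" and y: "y \<in> U \<inter> K"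
    then obtain n where "y \<in> A n"
      using A openin_subset unfolding metrizable_filtration_def by blast
    \<comment> \<open>The trace \<open>A n \<inter> K\<close> need not be open in \<open>K\<close>,
      so the pooled bases are claimed to form only a network.\<close>
    then have "\<exists>V\<in>\<B> n. y \<in> V \<and> V \<subseteq> U \<inter> (A n \<inter> K)"
      using \<B>(2)[of n "U \<inter> (A n \<inter> K)" y] openin_subtopology_Int[OF U] y by blast
    then show "\<exists>V\<in>\<Union>n. \<B> n. y \<in> V \<and> V \<inter> K \<subseteq> U" by blast
  qed
qed

theorem theorem2:
  fixes X :: "'a topology"
  shows "strongly_sigma_metrizable X \<longleftrightarrow> super_sigma_metrizable X"
proof
  assume "strongly_sigma_metrizable X"
  then obtain A where A: "metrizable_filtration X A"
    and seq: "\<And>x :: nat \<Rightarrow> 'a. range x \<subseteq> topspace X \<Longrightarrow> \<exists>l. limitin X x l sequentially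
      \<Longrightarrow> \<exists>n. range x \<subseteq> A n"
    unfolding strongly_sigma_metrizable_def by blast
  have "\<exists>n. K \<subseteq> A n" if K: "compactin X K" for K
  proof (rule ccontr)
    assume "\<nexists>n. K \<subseteq> A n"
    then have "\<forall>n. \<exists>y. y \<in> K \<and> y \<notin> A n"
      by blast
    then obtain x where x: "\<And>n. x n \<in> K" "\<And>n. x n \<notin> A n"
      by metis
    obtain r l where r: "strict_mono (r :: nat \<Rightarrow> nat)" and "limitin X (x \<circ> r) l sequentially"
      using metrizable_filtration_compactin_countable_network[OF A K]
        compactin_countable_network_convergent_subsequence[OF K] x(1)
      by (metis image_subsetI)
    then obtain n where n: "range (x \<circ> r) \<subseteq> A n"
      using seq[of "x \<circ> r"] x(1) compactin_subset_topspace[OF K] by fastforce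
    \<comment> \<open>Since \<open>n \<le> r n\<close>, the term \<open>x (r n)\<close> lies in
      \<open>A (r n)\<close>, contrary to the choice of \<open>x\<close>.\<close>
    have "A n \<subseteq> A (r n)"
      using A seq_suble[OF r] unfolding metrizable_filtration_def by (metis lift_Suc_mono_le)
    then show False using n x(2) by fastforce
  qed
  then show "super_sigma_metrizable X"
    using A unfolding super_sigma_metrizable_def by blast
next
  assume "super_sigma_metrizable X"
  then obtain A where A: "metrizable_filtration X A"
    and compact: "\<And>K. compactin X K \<Longrightarrow> \<exists>n. K \<subseteq> A n"
    unfolding super_sigma_metrizable_def by blast
  have "\<exists>n. range x \<subseteq> A n"
    if "range x \<subseteq> topspace X" "limitin X x l sequentially" for x :: "nat \<Rightarrow> 'a" and l
    \<comment> \<open>The compact set used is \<open>insert l (range x)\<close>.\<close>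
    using compact[OF compactin_sequence_with_limit[OF that(2) subset_refl that(1)]] by blast
  then show "strongly_sigma_metrizable X"
    using A unfolding strongly_sigma_metrizable_def by blast
qed

end
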